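(* Let $\Bbbk$ be a field of characteristic zero, let $n\ge1$ be an integer and $a\in\Bbbk$. The relations in $R=R(n,a)$, with respect to the generators $X_0,\dots,X_n$, are exactly the $\binom{n+1}{2}$ relations \[ X_i\ast X_j-X_j\ast X_i=\sum_{k=1}^{j}\binom{-(a+i)}{k}X_{j-k}\ast X_{i}-\sum_{\ell=1}^{i}\binom{-(a+j)}{\ell}X_{i-\ell}\ast X_{j},\qquad 0\le i<j\le n.\] That is, $R(n,a)$ is the $\Bbbk$-algebra presented by the generators $X_0,\dots,X_n$ and these relations.
   Context: Let $A=\Bbbk[X_0,\dots,X_n]$ be the commutative polynomial ring, $\partial_i=\partial/\partial X_i$, and define the derivations $\Delta=\sum_{i=1}^{n}X_{i-1}\partial_i$ and $\Gamma_a=\sum_{i=0}^n (a+i)X_i\partial_i$ of $A$. For $k\in\mathbb{N}$ put $\binom{\Gamma_a}{k}=\frac{1}{k!}\Gamma_a(\Gamma_a-1)\cdots(\Gamma_a-(k-1))$. Then $R(n,a)$ is the associative $\Bbbk$-algebra with underlying vector space $A$ and multiplication $f\ast g=\sum_{k\ge 0}\Delta^k(f)\binom{\Gamma_a}{k}(g)$. For $b\in\Bbbk$, $\binom{b}{k}=\frac{b(b-1)\cdots(b-k+1)}{k!}$. *)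

theory Defs
  imports "HOL-Library.Poly_Mapping" "HOL-Algebra.QuotRing" "HOL-Algebra.Module"
begin

text \<open>
  Commutative polynomials in the indeterminates $X_0, X_1, \ldots$ are finitely supported maps
  from monomials (finitely supported exponent functions) to coefficients; the convolution product
  of \<^theory>\<open>HOL-Library.Poly_Mapping\<close> is the polynomial product, and
  \<open>single 0 c\<close> is the constant polynomial \<open>c\<close>.  Restricting to
  $X_0, \ldots, X_n$ happens in the carrier of the algebra.
\<close>

type_synonym 'k mpoly = "(nat \<Rightarrow>\<^sub>0 nat) \<Rightarrow>\<^sub>0 'k"

definition indet :: "nat \<Rightarrow> 'k::field_char_0 mpoly" where
  "indet i = Poly_Mapping.single (Poly_Mapping.single i 1) 1"

text \<open>For \<open>lookup m i = 0\<close> the truncated exponent is harmless: the coefficient vanishes.\<close>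

definition partial :: "nat \<Rightarrow> 'k::field_char_0 mpoly \<Rightarrow> 'k mpoly" where
  "partial i f = (\<Sum>m\<in>Poly_Mapping.keys f.
     Poly_Mapping.single (m - Poly_Mapping.single i 1)
       (of_nat (Poly_Mapping.lookup m i) * Poly_Mapping.lookup f m))"

definition Delta :: "nat \<Rightarrow> 'k::field_char_0 mpoly \<Rightarrow> 'k mpoly" where
  "Delta n f = (\<Sum>i=1..n. indet (i - 1) * partial i f)"

definition Gamma :: "nat \<Rightarrow> 'k::field_char_0 \<Rightarrow> 'k mpoly \<Rightarrow> 'k mpoly" where
  "Gamma n a f = (\<Sum>i=0..n. Poly_Mapping.single 0 (a + of_nat i) * indet i * partial i f)"

primrec Gamma_falling :: "nat \<Rightarrow> 'k::field_char_0 \<Rightarrow> nat \<Rightarrow> 'k mpoly \<Rightarrow> 'k mpoly" where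
  "Gamma_falling n a 0 g = g"
| "Gamma_falling n a (Suc k) g =
     Gamma_falling n a k (Gamma n a g - Poly_Mapping.single 0 (of_nat k) * g)"

definition Gamma_choose :: "nat \<Rightarrow> 'k::field_char_0 \<Rightarrow> nat \<Rightarrow> 'k mpoly \<Rightarrow> 'k mpoly" where
  "Gamma_choose n a k g = Poly_Mapping.single 0 (1 / fact k) * Gamma_falling n a k g"

text \<open>
  \<^const>\<open>Sum_any\<close> sums over all \<open>k\<close> with a nonzero summand; there are only finitely many of
  them because \<^const>\<open>Delta\<close> is locally nilpotent.
\<close>

definition star :: "nat \<Rightarrow> 'k::field_char_0 \<Rightarrow> 'k mpoly \<Rightarrow> 'k mpoly \<Rightarrow> 'k mpoly" where
  "star n a f g = Sum_any (\<lambda>k. (Delta n ^^ k) f * Gamma_choose n a k g)"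

definition R_alg :: "nat \<Rightarrow> 'k::field_char_0 \<Rightarrow> ('k, 'k mpoly) module" where
  "R_alg n a = \<lparr>carrier = {f. \<forall>m\<in>Poly_Mapping.keys f. Poly_Mapping.keys m \<subseteq> {0..n}},
     mult = star n a, one = 1, zero = 0, add = (+),
     smult = (\<lambda>c f. Poly_Mapping.single 0 c * f)\<rparr>"

text \<open>
  The free associative algebra is the monoid algebra of the free monoid of words.  Words get a
  type of their own, as \<^class>\<open>monoid_add\<close> (the class over which
  \<^theory>\<open>HOL-Library.Poly_Mapping\<close> forms the convolution product) is not instantiated for
  lists; the sum of two words is their concatenation.
\<close>

datatype 'a free_word = Free_Word (letters: "'a list")

instantiation free_word :: (type) monoid_add
begin

definition zero_free_word :: "'a free_word" where
  "0 = Free_Word []"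

definition plus_free_word :: "'a free_word \<Rightarrow> 'a free_word \<Rightarrow> 'a free_word" where
  "v + w = Free_Word (letters v @ letters w)"

instance
  by standard (simp_all add: zero_free_word_def plus_free_word_def)

end

type_synonym 'k npoly = "nat free_word \<Rightarrow>\<^sub>0 'k"

definition gen :: "nat \<Rightarrow> 'k::field_char_0 npoly" where
  "gen i = Poly_Mapping.single (Free_Word [i]) 1"

definition free_algebra :: "nat \<Rightarrow> ('k::field_char_0, 'k npoly) module" where
  "free_algebra n = \<lparr>carrier = {p. \<forall>w\<in>Poly_Mapping.keys p. set (letters w) \<subseteq> {0..n}},
     mult = (*), one = 1, zero = 0, add = (+),
     smult = (\<lambda>c p. Poly_Mapping.single 0 c * p)\<rparr>"

definition relator :: "'k::field_char_0 \<Rightarrow> nat \<Rightarrow> nat \<Rightarrow> 'k npoly" where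
  "relator a i j = (gen i * gen j - gen j * gen i) -
     ((\<Sum>k=1..j. Poly_Mapping.single 0 ((- (a + of_nat i)) gchoose k) * (gen (j - k) * gen i)) -
      (\<Sum>l=1..i. Poly_Mapping.single 0 ((- (a + of_nat j)) gchoose l) * (gen (i - l) * gen j)))"

definition relators :: "nat \<Rightarrow> 'k::field_char_0 \<Rightarrow> 'k npoly set" where
  "relators n a = {relator a i j | i j. i < j \<and> j \<le> n}"

definition relation_ideal :: "nat \<Rightarrow> 'k::field_char_0 \<Rightarrow> 'k npoly set" where
  "relation_ideal n a = Idl\<^bsub>free_algebra n\<^esub> (relators n a)"

text \<open>
  The free algebra is a ring containing the relators, so that the library's generated ideal and
  quotient ring are meaningful here.
\<close>

lemma one_closed_free_algebra: "1 \<in> carrier (free_algebra n)"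
  by (simp add: free_algebra_def zero_free_word_def flip: single_one)

lemma gen_closed: "i \<le> n \<Longrightarrow> gen i \<in> carrier (free_algebra n)"
  by (simp add: gen_def free_algebra_def)

lemma const_closed: "Poly_Mapping.single 0 c \<in> carrier (free_algebra n)"
  by (simp add: free_algebra_def zero_free_word_def)

lemma add_closed:
  "p \<in> carrier (free_algebra n) \<Longrightarrow> q \<in> carrier (free_algebra n) \<Longrightarrow> p + q \<in> carrier (free_algebra n)"
  unfolding free_algebra_def using Poly_Mapping.keys_add[of p q] by fastforce

lemma uminus_closed: "p \<in> carrier (free_algebra n) \<Longrightarrow> - p \<in> carrier (free_algebra n)"
  unfolding free_algebra_def by (auto simp: in_keys_iff)

lemma diff_closed:
  "p \<in> carrier (free_algebra n) \<Longrightarrow> q \<in> carrier (free_algebra n) \<Longrightarrow> p - q \<in> carrier (free_algebra n)"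
  using add_closed[of p n "- q"] uminus_closed[of q n] by simp

lemma mult_closed:
  "p \<in> carrier (free_algebra n) \<Longrightarrow> q \<in> carrier (free_algebra n) \<Longrightarrow> p * q \<in> carrier (free_algebra n)"
  unfolding free_algebra_def using Poly_Mapping.keys_mult[of p q]
  by (fastforce simp: plus_free_word_def)

lemma sum_closed:
  "(\<And>i. i \<in> S \<Longrightarrow> f i \<in> carrier (free_algebra n)) \<Longrightarrow> sum f S \<in> carrier (free_algebra n)"
proof (induction S rule: infinite_finite_induct)
  case (insert s S)
  then show ?case by (simp add: add_closed)
qed (simp_all add: free_algebra_def)

lemma ring_free_algebra: "ring (free_algebra n :: ('k::field_char_0, 'k npoly) module)"
proof (rule ringI)
  let ?F = "free_algebra n :: ('k, 'k npoly) module"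
  have ops: "mult ?F = (*)" "one ?F = 1" "zero ?F = 0" "add ?F = (+)"
    by (simp_all add: free_algebra_def)
  have zero: "0 \<in> carrier ?F"
    by (simp add: free_algebra_def)
  show "abelian_group ?F"
    by (rule abelian_groupI)
       (auto simp: ops zero add_closed algebra_simps intro: bexI[OF _ uminus_closed])
  show "monoid ?F"
    by (rule monoidI) (auto simp: ops one_closed_free_algebra mult_closed mult.assoc)
qed (simp_all add: free_algebra_def algebra_simps)

lemma relators_closed: "relators n a \<subseteq> carrier (free_algebra n)"
  by (auto simp: relators_def relator_def
      intro!: diff_closed sum_closed mult_closed const_closed gen_closed)

end

theory Submission
  imports Defs "HOL-Computational_Algebra.Formal_Power_Series"
begin

text \<open>
  If \<open>g\<close> is an eigenvector of \<open>\<Gamma>\<close> with eigenvalue \<open>b\<close>, then \<open>f \<star> g = (1 + \<Delta>)\<^sup>b(f) g\<close>.  Vandermonde's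
  identity makes these operators additive in \<open>b\<close>; together with the Leibniz rule this gives
  associativity.  It also inverts the formula: the commutative product \<open>X\<^sub>i g\<close> equals
  \<open>\<Sum>\<^sub>l (-b choose l) X\<^bsub>i-l\<^esub> \<star> g\<close>, and the relations say precisely that the two resulting words for
  \<open>X\<^sub>i X\<^sub>j = X\<^sub>j X\<^sub>i\<close> agree.

  To see that there are no further relations, send a commutative monomial to the element of the free
  algebra obtained by iterating that formula over its sorted list of indeterminates.  Modulo the
  relations the order of the list is irrelevant, because the operators involved commute: after a
  Vandermonde summation their composite is a combination of the words for \<open>X\<^bsub>i-q\<^esub> X\<^bsub>j-k\<^esub>\<close> with
  coefficients \<open>(-b choose k) (-b-k choose q)\<close>, which are symmetric in \<open>k\<close> and \<open>q\<close>.  Hence the map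
  intertwines left multiplication by \<open>X\<^sub>i\<close> in \<open>R(n,a)\<close> with that by the \<open>i\<close>-th generator, so it
  inverts the evaluation homomorphism modulo the relations.
\<close>

section \<open>Linear extension and binomial sums\<close>

abbreviation cst :: "'k \<Rightarrow> 'b::monoid_add \<Rightarrow>\<^sub>0 'k::field_char_0" where
  "cst c \<equiv> Poly_Mapping.single 0 c"

lemma poly_mapping_sum_singles:
  "(\<Sum>k\<in>Poly_Mapping.keys f. Poly_Mapping.single k (Poly_Mapping.lookup f k)) = f"
  by (rule poly_mapping_eqI) (simp add: lookup_sum lookup_single when_def in_keys_iff)

lemma poly_mapping_add_induct [case_names zero single add]:
  fixes f :: "'b \<Rightarrow>\<^sub>0 'k::comm_monoid_add"
  assumes "P 0" "\<And>k c. P (Poly_Mapping.single k c)" "\<And>f g. P f \<Longrightarrow> P g \<Longrightarrow> P (f + g)"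
  shows "P f"
proof -
  have "P (\<Sum>k\<in>K. Poly_Mapping.single k (Poly_Mapping.lookup f k))" if "finite K" for K
    using that by (induction K rule: finite_induct) (auto intro: assms)
  then show ?thesis
    using poly_mapping_sum_singles[of f] by (metis finite_keys)
qed

lemma cst_commute: "cst c * p = p * (cst c :: 'b::monoid_add \<Rightarrow>\<^sub>0 'k::field_char_0)"
  by (induction p rule: poly_mapping_add_induct) (simp_all add: mult_single algebra_simps)

lemma cst_mult: "cst (c * d) = cst c * (cst d :: 'b::monoid_add \<Rightarrow>\<^sub>0 'k::field_char_0)"
  by (simp add: mult_single)

lemma cst_left_commute: "cst c * (p * q) = p * (cst c * (q :: 'b::monoid_add \<Rightarrow>\<^sub>0 'k::field_char_0))"
  by (metis cst_commute mult.assoc)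

lemma single_sum: "Poly_Mapping.single m (sum c K) = (\<Sum>k\<in>K. Poly_Mapping.single m (c k))"
  by (induction K rule: infinite_finite_induct) (simp_all add: single_add)

text \<open>Partial derivatives, the evaluation and the lift back are all given on a basis of
  monomials or words, so their linearity is proved once here. Scalars act through
  \<open>cst\<close>, which is central even in the free algebra.\<close>

definition lin_ext :: "('b \<Rightarrow> 'c \<Rightarrow>\<^sub>0 'k) \<Rightarrow> ('b \<Rightarrow>\<^sub>0 'k) \<Rightarrow> 'c::monoid_add \<Rightarrow>\<^sub>0 'k::field_char_0" where
  "lin_ext F f = (\<Sum>k\<in>Poly_Mapping.keys f. cst (Poly_Mapping.lookup f k) * F k)"

lemma lin_ext_single [simp]: "lin_ext F (Poly_Mapping.single k c) = cst c * F k"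
  by (simp add: lin_ext_def)

lemma lin_ext_zero [simp]: "lin_ext F 0 = 0"
  by (simp add: lin_ext_def)

lemma lin_ext_add: "lin_ext F (f + g) = lin_ext F f + lin_ext F g"
  unfolding lin_ext_def
  by (rule setsum_keys_plus_distrib) (simp_all add: single_add algebra_simps)

lemma lin_ext_diff: "lin_ext F (f - g) = lin_ext F f - lin_ext F g"
  using lin_ext_add[of F "f - g" g] by (simp add: algebra_simps)

lemma lin_ext_sum: "lin_ext F (sum f K) = (\<Sum>k\<in>K. lin_ext F (f k))"
  by (induction K rule: infinite_finite_induct) (simp_all add: lin_ext_add)

lemma lin_ext_cst_mult: "lin_ext F (cst c * f) = cst c * lin_ext F f"
  by (induction f rule: poly_mapping_add_induct)
     (simp_all add: lin_ext_add mult_single algebra_simps flip: mult.assoc)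

lemma sum_triangle:
  fixes g :: "nat \<Rightarrow> nat \<Rightarrow> 'a::comm_monoid_add"
  assumes "\<And>j k. j + k > N \<Longrightarrow> g j k = 0"
  shows "(\<Sum>j\<le>N. \<Sum>k\<le>N. g j k) = (\<Sum>q\<le>N. \<Sum>j\<le>q. g j (q - j))"
proof -
  have "(\<Sum>j\<le>N. \<Sum>k\<le>N. g j k) = (\<Sum>(j, k)\<in>{..N} \<times> {..N}. g j k)"
    by (rule sum.cartesian_product)
  also have "\<dots> = (\<Sum>(j, k)\<in>{(j, k). j + k \<le> N}. g j k)"
    using assms by (intro sum.mono_neutral_right) (auto simp: not_le[symmetric])
  also have "\<dots> = (\<Sum>q\<le>N. \<Sum>j\<le>q. g j (q - j))"
    by (rule sum.triangle_reindex_eq)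
  finally show ?thesis .
qed

text \<open>Vandermonde's identity, read as \<open>(1 + S)^b (1 + S)^c = (1 + S)^(b + c)\<close> for
  a nilpotent shift \<open>S\<close>, with \<open>v s\<close> in the role of \<open>S^s v\<close>.
  The form for sequences covers both the powers of \<open>Delta\<close> and the products with
  \<open>gen_shift\<close> in the free algebra.\<close>

lemma gbinomial_shift_sum:
  fixes v :: "nat \<Rightarrow> 'b::monoid_add \<Rightarrow>\<^sub>0 'k::field_char_0"
  assumes "\<And>s. s > N \<Longrightarrow> v s = 0"
  shows "(\<Sum>k\<le>N. cst (b gchoose k) * (\<Sum>l\<le>N. cst (c gchoose l) * v (k + l)))
       = (\<Sum>s\<le>N. cst ((b + c) gchoose s) * v s)"
proof -
  have "(\<Sum>k\<le>N. cst (b gchoose k) * (\<Sum>l\<le>N. cst (c gchoose l) * v (k + l)))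
      = (\<Sum>k\<le>N. \<Sum>l\<le>N. cst ((b gchoose k) * (c gchoose l)) * v (k + l))"
    by (simp add: sum_distrib_left cst_mult mult.assoc)
  also have "\<dots> = (\<Sum>q\<le>N. \<Sum>k\<le>q. cst ((b gchoose k) * (c gchoose (q - k))) * v (k + (q - k)))"
    using assms by (intro sum_triangle) simp
  also have "\<dots> = (\<Sum>q\<le>N. cst (\<Sum>k\<le>q. (b gchoose k) * (c gchoose (q - k))) * v q)"
    by (intro sum.cong) (simp_all add: single_sum sum_distrib_right)
  finally show ?thesis
    by (simp add: gbinomial_Vandermonde flip: atLeast0AtMost)
qed

text \<open>By trinomial revision both sides equal \<open>(- b) gchoose (k + q)\<close> times
  \<open>(k + q) choose k\<close>.\<close>

lemma gbinomial_mult_shift_commute: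
  fixes b :: "'k::field_char_0"
  shows "((- b) gchoose k) * ((- b - of_nat k) gchoose q) = ((- b) gchoose q) * ((- b - of_nat q) gchoose k)"
proof -
  have "(of_nat (k + q) :: 'k) gchoose k = of_nat (k + q) gchoose q"
    using gbinomial_of_nat_symmetric[of k "k + q", where 'a = 'k] by simp
  then show ?thesis
    using gbinomial_trinomial_revision[of k "k + q" "- b"] gbinomial_trinomial_revision[of q "k + q" "- b"]
    by simp
qed

section \<open>Partial derivatives and the derivation \<open>Delta\<close>\<close>

lemma partial_eq_lin_ext:
  "partial i = lin_ext (\<lambda>m. Poly_Mapping.single (m - Poly_Mapping.single i 1) (of_nat (Poly_Mapping.lookup m i)))"
  by (rule ext) (simp add: partial_def lin_ext_def mult_single mult.commute)

lemma partial_single: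
  "partial i (Poly_Mapping.single m c) =
     Poly_Mapping.single (m - Poly_Mapping.single i 1) (of_nat (Poly_Mapping.lookup m i) * c)"
  by (simp add: partial_eq_lin_ext mult_single mult.commute)

lemma partial_add: "partial i (f + g) = partial i f + partial i g"
  by (simp add: partial_eq_lin_ext lin_ext_add)

lemma partial_cst_mult: "partial i (cst c * f) = cst c * partial i f"
  by (simp add: partial_eq_lin_ext lin_ext_cst_mult)

lemma partial_zero [simp]: "partial i 0 = 0"
  by (simp add: partial_eq_lin_ext)

lemma monom_diff_single:
  fixes m m' :: "nat \<Rightarrow>\<^sub>0 nat"
  assumes "Poly_Mapping.lookup m i > 0"
  shows "m + m' - Poly_Mapping.single i 1 = (m - Poly_Mapping.single i 1) + m'"
  using assms by (intro poly_mapping_eqI) (auto simp: lookup_add lookup_minus lookup_single when_def)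

lemma partial_mult: "partial i (f * g) = partial i f * g + f * partial i g"
proof (induction f rule: poly_mapping_add_induct)
  case (single m c)
  show ?case
  proof (induction g rule: poly_mapping_add_induct)
    case (single m' c')
    let ?e = "Poly_Mapping.single i (1::nat)"
    have "Poly_Mapping.single (m + m' - ?e) (of_nat (Poly_Mapping.lookup m i) * d)
        = Poly_Mapping.single (m - ?e + m') (of_nat (Poly_Mapping.lookup m i) * d)" for d :: 'a
      \<comment> \<open>If \<open>X_i\<close> does not divide the monomial, the truncated exponents
        may differ, but the coefficient is zero.\<close>
      by (cases "Poly_Mapping.lookup m i > 0") (auto simp: monom_diff_single simp del: One_nat_def)
    moreover have "Poly_Mapping.single (m + m' - ?e) (of_nat (Poly_Mapping.lookup m' i) * d)
        = Poly_Mapping.single (m + (m' - ?e)) (of_nat (Poly_Mapping.lookup m' i) * d)" for d :: 'a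
      using monom_diff_single[of m' i m]
      by (cases "Poly_Mapping.lookup m' i > 0") (auto simp: add.commute simp del: One_nat_def)
    ultimately show ?case
      by (simp add: mult_single partial_single lookup_add distrib_right single_add mult.assoc
          mult.left_commute[of c] del: One_nat_def)
  qed (simp_all add: partial_add algebra_simps)
qed (simp_all add: partial_add algebra_simps)

lemma Delta_add: "Delta n (f + g) = Delta n f + Delta n g"
  by (simp add: Delta_def partial_add distrib_left sum.distrib)

lemma Delta_zero [simp]: "Delta n 0 = 0"
  by (simp add: Delta_def)

lemma Delta_mult: "Delta n (f * g) = Delta n f * g + f * Delta n g"
  by (simp add: Delta_def partial_mult sum_distrib_left sum_distrib_right sum.distrib algebra_simps)

lemma Delta_cst_mult: "Delta n (cst c * f) = cst c * Delta n f"
  by (simp add: Delta_def partial_cst_mult sum_distrib_left mult.left_commute)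

lemma Delta_single:
  "Delta n (Poly_Mapping.single m c) = (\<Sum>i=1..n.
     Poly_Mapping.single (Poly_Mapping.single (i - 1) 1 + (m - Poly_Mapping.single i 1))
       (of_nat (Poly_Mapping.lookup m i) * c))"
  by (simp add: Delta_def partial_single indet_def mult_single)

lemma Delta_pow_add: "(Delta n ^^ k) (f + g) = (Delta n ^^ k) f + (Delta n ^^ k) g"
  by (induction k) (simp_all add: Delta_add)

lemma Delta_pow_zero [simp]: "(Delta n ^^ k) 0 = 0"
  by (induction k) simp_all

lemma Delta_pow_cst_mult: "(Delta n ^^ k) (cst c * f) = cst c * (Delta n ^^ k) f"
  by (induction k) (simp_all add: Delta_cst_mult)

lemma Delta_pow_sum: "(Delta n ^^ k) (sum f K) = (\<Sum>j\<in>K. (Delta n ^^ k) (f j))"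
  by (induction K rule: infinite_finite_induct) (simp_all add: Delta_pow_add)

text \<open>Each application of \<open>Delta\<close> lowers this weight by one, hence local nilpotency.\<close>

definition index_weight :: "(nat \<Rightarrow>\<^sub>0 nat) \<Rightarrow> nat" where
  "index_weight m = (\<Sum>j\<in>Poly_Mapping.keys m. j * Poly_Mapping.lookup m j)"

lemma index_weight_add: "index_weight (m + m') = index_weight m + index_weight m'"
  unfolding index_weight_def by (rule setsum_keys_plus_distrib) (simp_all add: algebra_simps)

lemma index_weight_single [simp]: "index_weight (Poly_Mapping.single i k) = i * k"
  by (simp add: index_weight_def)

lemma single_add_diff:
  fixes m :: "nat \<Rightarrow>\<^sub>0 nat"
  assumes "Poly_Mapping.lookup m i > 0"
  shows "Poly_Mapping.single i 1 + (m - Poly_Mapping.single i 1) = m"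
  using assms by (intro poly_mapping_eqI) (auto simp: lookup_add lookup_minus lookup_single when_def)

lemma Delta_pow_single_eq_0:
  "index_weight m < k \<Longrightarrow> (Delta n ^^ k) (Poly_Mapping.single m c) = 0"
proof (induction k arbitrary: m c)
  case (Suc k)
  have "(Delta n ^^ k) (Poly_Mapping.single (Poly_Mapping.single (i - 1) 1 + (m - Poly_Mapping.single i 1))
      (of_nat (Poly_Mapping.lookup m i) * c)) = 0" if "i \<in> {1..n}" for i
  proof (cases "Poly_Mapping.lookup m i > 0")
    case True
    have "index_weight m = index_weight (Poly_Mapping.single i 1 + (m - Poly_Mapping.single i 1))"
      using single_add_diff[OF True] by simp
    then show ?thesis
      using Suc.prems that by (intro Suc.IH) (auto simp: index_weight_add simp del: One_nat_def)
  qed simp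
  then show ?case
    by (simp add: funpow_swap1 Delta_single Delta_pow_sum)
qed simp

lemma Delta_nilpotent: "\<exists>N. \<forall>k>N. (Delta n ^^ k) f = 0"
proof (induction f rule: poly_mapping_add_induct)
  case (add f g)
  then obtain N M where "\<forall>k>N. (Delta n ^^ k) f = 0" "\<forall>k>M. (Delta n ^^ k) g = 0"
    by blast
  then show ?case
    by (intro exI[of _ "max N M"]) (simp add: Delta_pow_add)
qed (auto intro: Delta_pow_single_eq_0)

lemma Delta_pow_mult:
  "(Delta n ^^ k) (f * g) =
     (\<Sum>j\<le>k. of_nat (k choose j) * ((Delta n ^^ (k - j)) f * (Delta n ^^ j) g))"
proof (induction k)
  case (Suc k)
  let ?D = "Delta n"
  have step: "?D (of_nat r * (u * v)) = of_nat r * (?D u * v) + of_nat r * (u * ?D v)" for r u v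
    using Delta_cst_mult[of n "of_nat r" "u * v"] by (simp add: Delta_mult distrib_left)
  have Dsum: "?D (sum h K) = (\<Sum>j\<in>K. ?D (h j))" for h and K :: "nat set"
    using Delta_pow_sum[of 1 n h K] by simp
  let ?t = "\<lambda>j. (?D ^^ (Suc k - j)) f * (?D ^^ j) g"
  have "(?D ^^ Suc k) (f * g) = (\<Sum>j\<le>k. of_nat (k choose j) * ?t j) +
      (\<Sum>j\<le>k. of_nat (k choose j) * ?t (Suc j))"
    by (simp add: Suc Dsum step sum.distrib Suc_diff_le)
  \<comment> \<open>Appending the zero term \<open>j = Suc k\<close> allows an index shift, after
    which Pascal's rule merges the two sums.\<close>
  also have "(\<Sum>j\<le>k. of_nat (k choose j) * ?t j) = (\<Sum>j\<le>Suc k. of_nat (k choose j) * ?t j)"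
    by (simp add: binomial_eq_0)
  also have "\<dots> = ?t 0 + (\<Sum>j\<le>k. of_nat (k choose Suc j) * ?t (Suc j))"
    by (subst sum.atMost_Suc_shift) simp
  also have "\<dots> + (\<Sum>j\<le>k. of_nat (k choose j) * ?t (Suc j)) =
      ?t 0 + (\<Sum>j\<le>k. of_nat (Suc k choose Suc j) * ?t (Suc j))"
    by (simp add: algebra_simps sum.distrib)
  also have "\<dots> = (\<Sum>j\<le>Suc k. of_nat (Suc k choose j) * ?t j)"
    by (simp only: sum.atMost_Suc_shift[of _ k]) simp
  finally show ?case .
qed simp

section \<open>Associativity of the product\<close>

lemma Gamma_add: "Gamma n a (f + g) = Gamma n a f + Gamma n a g"
  by (simp add: Gamma_def partial_add distrib_left sum.distrib)

lemma Gamma_zero [simp]: "Gamma n a 0 = 0"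
  by (simp add: Gamma_def)

lemma Gamma_cst_mult: "Gamma n a (cst c * f) = cst c * Gamma n a f"
  by (simp add: Gamma_def partial_cst_mult sum_distrib_left mult.assoc mult.left_commute)

lemma Gamma_mult: "Gamma n a (f * g) = Gamma n a f * g + f * Gamma n a g"
  by (simp add: Gamma_def partial_mult sum_distrib_left sum_distrib_right sum.distrib algebra_simps)

text \<open>The eigenvalue of \<open>Gamma\<close> on the monomial \<open>m\<close>. Monomials
  diagonalise \<open>Gamma\<close>, so binomials in this operator reduce to scalars.\<close>

definition Gamma_weight :: "nat \<Rightarrow> 'k::field_char_0 \<Rightarrow> (nat \<Rightarrow>\<^sub>0 nat) \<Rightarrow> 'k" where
  "Gamma_weight n a m = (\<Sum>i\<le>n. (a + of_nat i) * of_nat (Poly_Mapping.lookup m i))"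

lemma Gamma_weight_add: "Gamma_weight n a (m + m') = Gamma_weight n a m + Gamma_weight n a m'"
  by (simp add: Gamma_weight_def lookup_add distrib_left sum.distrib)

lemma Gamma_weight_zero [simp]: "Gamma_weight n a 0 = 0"
  by (simp add: Gamma_weight_def)

lemma Gamma_weight_single:
  "i \<le> n \<Longrightarrow> Gamma_weight n a (Poly_Mapping.single i (Suc 0)) = a + of_nat i"
  by (simp add: Gamma_weight_def lookup_single when_def if_distrib[of "\<lambda>x. _ * of_nat x"] sum.delta' cong: if_cong)

lemma Gamma_single: "Gamma n a (Poly_Mapping.single m c) = cst (Gamma_weight n a m) * Poly_Mapping.single m c"
proof -
  have "cst (a + of_nat i) * indet i * partial i (Poly_Mapping.single m c) =
      Poly_Mapping.single m ((a + of_nat i) * of_nat (Poly_Mapping.lookup m i) * c)" for i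
    using single_add_diff[of m i]
    by (cases "Poly_Mapping.lookup m i > 0")
       (simp_all add: partial_single indet_def mult_single mult.assoc)
  then show ?thesis
    by (simp add: Gamma_def Gamma_weight_def mult_single sum_distrib_right atLeast0AtMost single_sum)
qed

text \<open>\<open>Delta\<close> replaces a factor \<open>X_i\<close> of weight \<open>a + i\<close>
  by \<open>X_(i-1)\<close> of weight \<open>a + i - 1\<close>, so it lowers \<open>Gamma\<close>
  eigenvalues by one.\<close>

lemma Gamma_Delta: "Gamma n a (Delta n f) = Delta n (Gamma n a f) - Delta n f"
proof (induction f rule: poly_mapping_add_induct)
  case (single m c)
  have Gsum: "Gamma n a (sum h K) = (\<Sum>j\<in>K. Gamma n a (h j))" for h and K :: "nat set"
    by (induction K rule: infinite_finite_induct) (simp_all add: Gamma_add)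
  let ?t = "\<lambda>i. Poly_Mapping.single (Poly_Mapping.single (i - 1) 1 + (m - Poly_Mapping.single i 1))
       (of_nat (Poly_Mapping.lookup m i) * c)"
  have "Gamma n a (?t i) = cst (Gamma_weight n a m - 1) * ?t i" if "i \<in> {1..n}" for i
  proof (cases "Poly_Mapping.lookup m i > 0")
    case True
    have "Gamma_weight n a m = Gamma_weight n a (Poly_Mapping.single i 1 + (m - Poly_Mapping.single i 1))"
      using single_add_diff[OF True] by simp
    moreover obtain k where "i = Suc k" "k \<le> n" "Suc k \<le> n"
      using \<open>i \<in> {1..n}\<close> by (cases i) auto
    ultimately show ?thesis
      by (simp add: Gamma_single Gamma_weight_add Gamma_weight_single algebra_simps)
  qed simp
  then have "Gamma n a (Delta n (Poly_Mapping.single m c)) =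
      cst (Gamma_weight n a m - 1) * Delta n (Poly_Mapping.single m c)"
    by (simp add: Delta_single Gsum sum_distrib_left del: One_nat_def)
  then show ?case
    by (simp add: Gamma_single Delta_cst_mult single_diff left_diff_distrib)
qed (simp_all add: Gamma_add Delta_add)

lemma Gamma_Delta_pow:
  assumes "Gamma n a q = cst b * q"
  shows "Gamma n a ((Delta n ^^ k) q) = cst (b - of_nat k) * (Delta n ^^ k) q"
proof (induction k)
  case (Suc k)
  have "cst (b - of_nat (Suc k)) = cst (b - of_nat k) - (1 :: 'a mpoly)"
    by (simp add: diff_diff_eq add.commute flip: single_one single_diff)
  then show ?case
    by (simp add: Gamma_Delta Suc Delta_cst_mult left_diff_distrib del: of_nat_Suc)
qed (simp add: assms)

lemma Gamma_falling_add: "Gamma_falling n a k (f + g) = Gamma_falling n a k f + Gamma_falling n a k g"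
proof (induction k arbitrary: f g)
  case (Suc k)
  have "Gamma n a (f + g) - cst (of_nat k) * (f + g) =
      (Gamma n a f - cst (of_nat k) * f) + (Gamma n a g - cst (of_nat k) * g)"
    by (simp add: Gamma_add algebra_simps)
  then show ?case
    by (simp only: Gamma_falling.simps Suc)
qed simp

lemma Gamma_choose_add: "Gamma_choose n a k (f + g) = Gamma_choose n a k f + Gamma_choose n a k g"
  by (simp add: Gamma_choose_def Gamma_falling_add distrib_left)

lemma Gamma_falling_eigen:
  "Gamma n a q = cst b * q \<Longrightarrow> Gamma_falling n a k q = cst (\<Prod>i=0..<k. b - of_nat i) * q"
proof (induction k arbitrary: q)
  case (Suc k)
  let ?q = "cst (b - of_nat k) * q"
  have "Gamma n a ?q = cst b * ?q"
    by (simp add: Gamma_cst_mult Suc.prems mult.left_commute)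
  moreover have "Gamma n a q - cst (of_nat k) * q = ?q"
    by (simp add: Suc.prems single_diff algebra_simps)
  ultimately show ?case
    by (simp add: Suc.IH cst_mult mult.assoc)
qed simp

lemma Gamma_choose_eigen:
  assumes "Gamma n a q = cst b * q"
  shows "Gamma_choose n a k q = cst (b gchoose k) * q"
  by (simp add: Gamma_choose_def Gamma_falling_eigen[OF assms] gbinomial_prod_rev mult_single flip: mult.assoc)

text \<open>The binomial series \<open>(1 + \<Delta>)\<^sup>b\<close>.\<close>

definition Delta_binom :: "nat \<Rightarrow> 'k::field_char_0 \<Rightarrow> 'k mpoly \<Rightarrow> 'k mpoly" where
  "Delta_binom n b f = Sum_any (\<lambda>k. cst (b gchoose k) * (Delta n ^^ k) f)"

lemma Sum_any_eq_sum_atMost: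
  fixes g :: "nat \<Rightarrow> 'a::comm_monoid_add"
  assumes "\<And>k. k > N \<Longrightarrow> g k = 0"
  shows "Sum_any g = sum g {..N}"
  using assms by (intro Sum_any.expand_superset) (auto simp: not_le[symmetric])

lemma Delta_binom_eq:
  assumes "\<And>k. k > N \<Longrightarrow> (Delta n ^^ k) f = 0"
  shows "Delta_binom n b f = (\<Sum>k\<le>N. cst (b gchoose k) * (Delta n ^^ k) f)"
  unfolding Delta_binom_def using assms by (intro Sum_any_eq_sum_atMost) simp

lemma star_eq:
  assumes "\<And>k. k > N \<Longrightarrow> (Delta n ^^ k) f = 0"
  shows "star n a f g = (\<Sum>k\<le>N. (Delta n ^^ k) f * Gamma_choose n a k g)"
  unfolding star_def using assms by (intro Sum_any_eq_sum_atMost) simp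

lemma star_eigen:
  assumes "Gamma n a q = cst b * q"
  shows "star n a f q = Delta_binom n b f * q"
proof -
  obtain N where "\<forall>k>N. (Delta n ^^ k) f = 0"
    using Delta_nilpotent by blast
  then show ?thesis
    by (simp add: star_eq[of N] Delta_binom_eq[of N] Gamma_choose_eigen[OF assms] sum_distrib_right mult.assoc mult.left_commute)
qed

lemma star_single: "star n a f (Poly_Mapping.single m c) =
    Delta_binom n (Gamma_weight n a m) f * Poly_Mapping.single m c"
  by (rule star_eigen) (rule Gamma_single)

lemma star_add_right: "star n a f (g + h) = star n a f g + star n a f h"
proof -
  obtain N where "\<forall>k>N. (Delta n ^^ k) f = 0"
    using Delta_nilpotent by blast
  then show ?thesis
    by (simp add: star_eq[of N] Gamma_choose_add distrib_left sum.distrib)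
qed

lemma star_add_left: "star n a (f + g) h = star n a f h + star n a g h"
proof -
  obtain N M where "\<forall>k>N. (Delta n ^^ k) f = 0" "\<forall>k>M. (Delta n ^^ k) g = 0"
    using Delta_nilpotent by metis
  then show ?thesis
    by (simp add: star_eq[of "max N M"] Delta_pow_add distrib_right sum.distrib)
qed

lemma star_zero_right [simp]: "star n a f 0 = 0"
  using star_add_right[of n a f 0 0] by simp

lemma star_zero_left [simp]: "star n a 0 g = 0"
  using star_add_left[of n a 0 0 g] by simp

lemma star_sum_right: "star n a f (sum g K) = (\<Sum>j\<in>K. star n a f (g j))"
  by (induction K rule: infinite_finite_induct) (simp_all add: star_add_right)

lemma star_sum_left: "star n a (sum f K) g = (\<Sum>j\<in>K. star n a (f j) g)"
  by (induction K rule: infinite_finite_induct) (simp_all add: star_add_left)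

lemma Delta_binom_cst_mult: "Delta_binom n b (cst c * f) = cst c * Delta_binom n b f"
proof -
  obtain N where "\<forall>k>N. (Delta n ^^ k) f = 0"
    using Delta_nilpotent by blast
  then show ?thesis
    by (simp add: Delta_binom_eq[of N] Delta_pow_cst_mult sum_distrib_left mult.left_commute)
qed

lemma star_cst_mult_left: "star n a (cst c * f) g = cst c * star n a f g"
  by (induction g rule: poly_mapping_add_induct)
     (simp_all add: star_single Delta_binom_cst_mult star_add_right distrib_left mult.assoc)

lemma star_cst_mult_right: "star n a f (cst c * g) = cst c * star n a f g"
  by (induction g rule: poly_mapping_add_induct)
     (simp_all add: star_single mult_single star_add_right distrib_left mult.left_commute)

lemma Delta_pow_Delta_pow: "(Delta n ^^ k) ((Delta n ^^ l) f) = (Delta n ^^ (k + l)) f"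
  by (simp add: funpow_add)

text \<open>Vandermonde in the form \<open>gbinomial_shift_sum\<close>; the truncation bound for
  \<open>f\<close> also serves for \<open>Delta_binom n c f\<close>, a combination of the
  \<open>Delta\<close> powers of \<open>f\<close>.\<close>

lemma Delta_binom_Delta_binom: "Delta_binom n b (Delta_binom n c f) = Delta_binom n (b + c) f"
proof -
  obtain N where N: "\<And>k. k > N \<Longrightarrow> (Delta n ^^ k) f = 0"
    using Delta_nilpotent by blast
  have pow: "(Delta n ^^ k) (Delta_binom n c f) = (\<Sum>l\<le>N. cst (c gchoose l) * (Delta n ^^ (k + l)) f)" for k
    by (simp add: Delta_binom_eq[OF N] Delta_pow_sum Delta_pow_cst_mult Delta_pow_Delta_pow)
  have "(Delta n ^^ k) (Delta_binom n c f) = 0" if "k > N" for k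
    using that by (simp add: pow N)
  then have "Delta_binom n b (Delta_binom n c f) =
      (\<Sum>k\<le>N. cst (b gchoose k) * (\<Sum>l\<le>N. cst (c gchoose l) * (Delta n ^^ (k + l)) f))"
    by (simp add: Delta_binom_eq[of N n "Delta_binom n c f"] pow)
  also have "\<dots> = Delta_binom n (b + c) f"
    by (simp add: gbinomial_shift_sum[of N "\<lambda>s. (Delta n ^^ s) f", OF N] Delta_binom_eq[OF N])
  finally show ?thesis .
qed

lemma Delta_binom_zero [simp]: "Delta_binom n 0 f = f"
proof -
  have "Delta_binom n 0 f = (\<Sum>k\<le>0. cst (0 gchoose k) * (Delta n ^^ k) f)"
    unfolding Delta_binom_def by (rule Sum_any_eq_sum_atMost) (simp add: gbinomial_0_left)
  then show ?thesis
    by simp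
qed

text \<open>With \<open>\<Delta> = \<Delta>\<^sub>1 + \<Delta>\<^sub>2\<close> acting on the two factors, this expands
  \<open>(1 + \<Delta>\<^sub>1 + \<Delta>\<^sub>2)\<^sup>b\<close> in powers of \<open>\<Delta>\<^sub>2\<close>.\<close>

lemma Delta_binom_mult:
  assumes "\<And>k. k > N \<Longrightarrow> (Delta n ^^ k) g = 0"
  shows "Delta_binom n b (f * g) =
    (\<Sum>j\<le>N. cst (b gchoose j) * (Delta_binom n (b - of_nat j) f * (Delta n ^^ j) g))"
proof -
  obtain L M where LM: "\<And>k. k > L \<Longrightarrow> (Delta n ^^ k) (f * g) = 0" "\<And>k. k > M \<Longrightarrow> (Delta n ^^ k) f = 0"
    using Delta_nilpotent by metis
  \<comment> \<open>Large enough that the series for \<open>f * g\<close> and \<open>f\<close> stop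
    by \<open>K\<close>, and that \<open>j + k > K\<close> forces \<open>k > M\<close> or
    \<open>j > N\<close>; hence a triangle of summands may be completed to a square.\<close>
  define K where "K = L + M + N"
  have fK: "(Delta n ^^ k) f = 0" if "k > K" for k
    using that by (intro LM(2)) (simp add: K_def)
  have van: "cst c * ((Delta n ^^ k) f * (Delta n ^^ j) g) = 0" if "j + k > K" for j k c
  proof -
    have "k > M \<or> j > N"
      using that by (auto simp: K_def)
    then show ?thesis
      using assms LM by auto
  qed
  have "Delta_binom n b (f * g) = (\<Sum>m\<le>K. cst (b gchoose m) * (Delta n ^^ m) (f * g))"
    by (rule Delta_binom_eq) (simp add: LM K_def)
  also have "\<dots> = (\<Sum>m\<le>K. \<Sum>j\<le>m. cst ((b gchoose j) * ((b - of_nat j) gchoose (m - j))) *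
      ((Delta n ^^ (m - j)) f * (Delta n ^^ j) g))"
  proof (intro sum.cong refl)
    fix m
    \<comment> \<open>Trinomial revision trades the Leibniz coefficient for one under which, for
      fixed \<open>j\<close>, the powers of \<open>Delta\<close> on \<open>f\<close> assemble to the
      series with exponent \<open>b - j\<close>.\<close>
    have step: "cst (b gchoose m) * (of_nat (m choose j) * h) =
        cst ((b gchoose j) * ((b - of_nat j) gchoose (m - j))) * h" if "j \<le> m" for j and h :: "'a mpoly"
    proof -
      have step: "cst (b gchoose m) * (of_nat (m choose j) * h) = cst ((b gchoose m) * of_nat (m choose j)) * h"
        by (simp add: cst_mult mult.assoc)
      then show ?thesis
        using gbinomial_trinomial_revision[OF that, of b] by (simp flip: binomial_gbinomial)
    qed
    show "cst (b gchoose m) * (Delta n ^^ m) (f * g) =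
        (\<Sum>j\<le>m. cst ((b gchoose j) * ((b - of_nat j) gchoose (m - j))) *
          ((Delta n ^^ (m - j)) f * (Delta n ^^ j) g))"
      unfolding Delta_pow_mult sum_distrib_left by (intro sum.cong refl step) simp
  qed
  also have "\<dots> = (\<Sum>j\<le>K. \<Sum>k\<le>K. cst ((b gchoose j) * ((b - of_nat j) gchoose k)) *
      ((Delta n ^^ k) f * (Delta n ^^ j) g))"
    by (rule sum_triangle[symmetric]) (rule van)
  also have "\<dots> = (\<Sum>j\<le>K. cst (b gchoose j) * (Delta_binom n (b - of_nat j) f * (Delta n ^^ j) g))"
    by (simp add: Delta_binom_eq[OF fK] sum_distrib_left sum_distrib_right cst_mult mult.assoc)
  also have "\<dots> = (\<Sum>j\<le>N. cst (b gchoose j) * (Delta_binom n (b - of_nat j) f * (Delta n ^^ j) g))"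
    using assms by (intro sum.mono_neutral_right) (auto simp: K_def)
  finally show ?thesis .
qed

text \<open>By additivity \<open>g\<close> and \<open>h\<close> may be monomials, of weights
  \<open>l\<close> and \<open>u\<close>. \<open>Delta_binom_mult\<close> expands the left side with
  exponent \<open>u - j + l\<close> on \<open>f\<close>, next to \<open>Delta^j g * h\<close>. This
  is exactly the \<open>Gamma\<close> eigenvalue of that product, so each summand is again a
  \<open>star\<close> product with left factor \<open>f\<close>.\<close>

lemma star_assoc: "star n a (star n a f g) h = star n a f (star n a g h)"
proof (induction h rule: poly_mapping_add_induct)
  case (single m' c')
  show ?case
  proof (induction g rule: poly_mapping_add_induct)
    case (single m c)
    let ?g = "Poly_Mapping.single m c" and ?h = "Poly_Mapping.single m' c'"
    let ?l = "Gamma_weight n a m" and ?u = "Gamma_weight n a m'"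
    obtain N where N: "\<And>k. k > N \<Longrightarrow> (Delta n ^^ k) ?g = 0"
      using Delta_nilpotent by metis
    have eig: "Gamma n a (cst d * ((Delta n ^^ j) ?g * ?h)) =
        cst (?u - of_nat j + ?l) * (cst d * ((Delta n ^^ j) ?g * ?h))" for j d
      by (simp only: Gamma_cst_mult Gamma_mult Gamma_Delta_pow[OF Gamma_single] Gamma_single single_add single_diff)
         (simp add: algebra_simps)
    have "star n a (star n a f ?g) ?h = Delta_binom n ?u (Delta_binom n ?l f * ?g) * ?h"
      by (simp add: star_single)
    also have "\<dots> = (\<Sum>j\<le>N. cst (?u gchoose j) * (Delta_binom n (?u - of_nat j + ?l) f * (Delta n ^^ j) ?g)) * ?h"
      by (simp add: Delta_binom_mult[OF N] Delta_binom_Delta_binom)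
    also have "\<dots> = (\<Sum>j\<le>N. Delta_binom n (?u - of_nat j + ?l) f * (cst (?u gchoose j) * ((Delta n ^^ j) ?g * ?h)))"
      by (simp add: sum_distrib_right mult.assoc mult.left_commute)
    also have "\<dots> = (\<Sum>j\<le>N. star n a f (cst (?u gchoose j) * ((Delta n ^^ j) ?g * ?h)))"
      by (simp only: star_eigen[OF eig])
    also have "\<dots> = star n a f (\<Sum>j\<le>N. cst (?u gchoose j) * ((Delta n ^^ j) ?g * ?h))"
      by (simp only: star_sum_right)
    also have "(\<Sum>j\<le>N. cst (?u gchoose j) * ((Delta n ^^ j) ?g * ?h)) = star n a ?g ?h"
      by (simp only: star_single[of n a ?g] Delta_binom_eq[OF N] sum_distrib_right mult.assoc)
    finally show ?case .
  qed (simp_all add: star_add_left star_add_right)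
qed (simp_all add: star_add_right)

lemma Delta_pow_one: "(Delta n ^^ k) (1 :: 'a::field_char_0 mpoly) = (if k = 0 then 1 else 0)"
  using Delta_pow_single_eq_0[of 0 k n "1 :: 'a"] by (simp add: index_weight_def)

lemma star_one_left [simp]: "star n a 1 g = g"
proof -
  have "star n a 1 g = (\<Sum>k\<le>0. (Delta n ^^ k) 1 * Gamma_choose n a k g)"
    by (rule star_eq) (simp add: Delta_pow_one)
  then show ?thesis
    by (simp add: Gamma_choose_def)
qed

lemma star_one_right [simp]: "star n a f 1 = f"
  using star_single[of n a f 0 1] by simp

lemma Delta_pow_indet:
  assumes "i \<le> n"
  shows "(Delta n ^^ k) (indet i :: 'a::field_char_0 mpoly) = (if k \<le> i then indet (i - k) else 0)"
proof (induction k)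
  case (Suc k)
  have "Delta n (indet j :: 'a mpoly) = (if j = 0 then 0 else indet (j - 1))" if "j \<le> n" for j
  proof -
    \<comment> \<open>The sum starts at 1, so \<open>X_0\<close> is killed; for
      \<open>j \<ge> 1\<close> the bound \<open>j \<le> n\<close> keeps the one surviving
      summand.\<close>
    have "Delta n (indet j :: 'a mpoly) = (\<Sum>i=1..n. if i = j then indet (j - 1) else 0)"
      unfolding indet_def Delta_single by (intro sum.cong) (auto simp: lookup_single when_def)
    then show ?thesis
      using that by (auto simp: sum.delta')
  qed
  then show ?case
    using Suc assms by (auto simp: Suc_diff_le not_le)
qed simp

section \<open>Evaluation of noncommutative polynomials\<close>

definition polys_upto :: "nat \<Rightarrow> 'k::field_char_0 mpoly set" where
  "polys_upto n = {f. \<forall>m\<in>Poly_Mapping.keys f. Poly_Mapping.keys m \<subseteq> {0..n}}"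

lemma polys_upto_zero [simp]: "0 \<in> polys_upto n"
  by (simp add: polys_upto_def)

lemma polys_upto_add: "f \<in> polys_upto n \<Longrightarrow> g \<in> polys_upto n \<Longrightarrow> f + g \<in> polys_upto n"
  using Poly_Mapping.keys_add[of f g] by (fastforce simp: polys_upto_def)

lemma polys_upto_uminus: "f \<in> polys_upto n \<Longrightarrow> - f \<in> polys_upto n"
  by (auto simp: polys_upto_def in_keys_iff)

lemma polys_upto_diff: "f \<in> polys_upto n \<Longrightarrow> g \<in> polys_upto n \<Longrightarrow> f - g \<in> polys_upto n"
  using polys_upto_add[of f n "- g"] polys_upto_uminus[of g n] by simp

lemma polys_upto_mult: "f \<in> polys_upto n \<Longrightarrow> g \<in> polys_upto n \<Longrightarrow> f * g \<in> polys_upto n"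
proof -
  assume *: "f \<in> polys_upto n" "g \<in> polys_upto n"
  have "Poly_Mapping.keys (m + m') \<subseteq> {0..n}"
    if "m \<in> Poly_Mapping.keys f" "m' \<in> Poly_Mapping.keys g" for m m'
    using that * Poly_Mapping.keys_add[of m m'] by (fastforce simp: polys_upto_def)
  then show ?thesis
    using Poly_Mapping.keys_mult[of f g] unfolding polys_upto_def by blast
qed

lemma polys_upto_sum: "(\<And>i. i \<in> K \<Longrightarrow> f i \<in> polys_upto n) \<Longrightarrow> sum f K \<in> polys_upto n"
  by (induction K rule: infinite_finite_induct) (auto intro: polys_upto_add)

lemma polys_upto_single: "Poly_Mapping.keys m \<subseteq> {0..n} \<Longrightarrow> Poly_Mapping.single m c \<in> polys_upto n"
  by (simp add: polys_upto_def)

lemma polys_upto_indet: "i \<le> n \<Longrightarrow> indet i \<in> polys_upto n"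
  by (simp add: indet_def polys_upto_single)

lemma polys_upto_partial: "f \<in> polys_upto n \<Longrightarrow> partial i f \<in> polys_upto n"
proof -
  have "Poly_Mapping.keys (m - Poly_Mapping.single i 1) \<subseteq> Poly_Mapping.keys m" for m :: "nat \<Rightarrow>\<^sub>0 nat"
    by (auto simp: in_keys_iff lookup_minus)
  then show "f \<in> polys_upto n \<Longrightarrow> partial i f \<in> polys_upto n"
    unfolding partial_def by (intro polys_upto_sum polys_upto_single) (auto simp: polys_upto_def)
qed

lemma polys_upto_Delta_pow: "f \<in> polys_upto n \<Longrightarrow> (Delta n ^^ k) f \<in> polys_upto n"
  by (induction k)
     (auto simp: Delta_def intro!: polys_upto_sum polys_upto_mult polys_upto_partial polys_upto_indet)

lemma polys_upto_Gamma: "f \<in> polys_upto n \<Longrightarrow> Gamma n a f \<in> polys_upto n"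
  unfolding Gamma_def
  by (intro polys_upto_sum polys_upto_mult polys_upto_partial polys_upto_indet polys_upto_single) auto

lemma polys_upto_Gamma_choose: "f \<in> polys_upto n \<Longrightarrow> Gamma_choose n a k f \<in> polys_upto n"
proof -
  have "Gamma_falling n a k f \<in> polys_upto n" if "f \<in> polys_upto n" for f
    using that
  proof (induction k arbitrary: f)
    case (Suc k)
    then show ?case
      unfolding Gamma_falling.simps
      by (intro Suc.IH polys_upto_diff polys_upto_mult polys_upto_Gamma polys_upto_single) auto
  qed simp
  then show "f \<in> polys_upto n \<Longrightarrow> ?thesis"
    by (simp add: Gamma_choose_def polys_upto_mult polys_upto_single)
qed

lemma polys_upto_star:
  assumes "f \<in> polys_upto n" "g \<in> polys_upto n"
  shows "star n a f g \<in> polys_upto n"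
proof -
  obtain N where "\<forall>k>N. (Delta n ^^ k) f = 0"
    using Delta_nilpotent by blast
  then show ?thesis
    using assms
    by (auto simp: star_eq[of N] intro!: polys_upto_sum polys_upto_mult polys_upto_Delta_pow polys_upto_Gamma_choose)
qed

lemma R_alg_simps:
  "carrier (R_alg n a) = polys_upto n" "monoid.mult (R_alg n a) = star n a" "one (R_alg n a) = 1"
  "zero (R_alg n a) = 0" "add (R_alg n a) = (+)" "smult (R_alg n a) = (\<lambda>c f. cst c * f)"
  by (simp_all add: R_alg_def polys_upto_def)

lemma ring_R_alg: "ring (R_alg n a)"
proof (rule ringI)
  show "abelian_group (R_alg n a)"
    by (rule abelian_groupI)
       (auto simp: R_alg_simps polys_upto_add algebra_simps intro: bexI[OF _ polys_upto_uminus])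
  have "1 \<in> polys_upto n"
    using polys_upto_single[of 0 n 1] by simp
  then show "monoid (R_alg n a)"
    by (intro monoidI) (auto simp: R_alg_simps polys_upto_star star_assoc)
qed (simp_all add: R_alg_simps star_add_left star_add_right)

lemma free_algebra_simps:
  "monoid.mult (free_algebra n) = (*)" "one (free_algebra n) = 1" "zero (free_algebra n) = 0"
  "add (free_algebra n) = (+)" "smult (free_algebra n) = (\<lambda>c p. cst c * p)"
  by (simp_all add: free_algebra_def)

section \<open>The evaluation homomorphism\<close>

primrec word_value :: "nat \<Rightarrow> 'k::field_char_0 \<Rightarrow> nat list \<Rightarrow> 'k mpoly" where
  "word_value n a [] = 1"
| "word_value n a (i # w) = star n a (indet i) (word_value n a w)"

definition npoly_value :: "nat \<Rightarrow> 'k::field_char_0 \<Rightarrow> 'k npoly \<Rightarrow> 'k mpoly" where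
  "npoly_value n a = lin_ext (\<lambda>w. word_value n a (letters w))"

lemma word_value_append: "word_value n a (v @ w) = star n a (word_value n a v) (word_value n a w)"
  by (induction v) (simp_all add: star_assoc)

lemma word_value_closed: "set w \<subseteq> {0..n} \<Longrightarrow> word_value n a w \<in> polys_upto n"
  by (induction w) (auto intro!: polys_upto_star polys_upto_indet simp: polys_upto_single simp flip: single_one)

lemma npoly_value_closed:
  assumes "p \<in> carrier (free_algebra n)"
  shows "npoly_value n a p \<in> polys_upto n"
  using assms unfolding npoly_value_def lin_ext_def free_algebra_def
  by (auto intro!: polys_upto_sum polys_upto_mult polys_upto_single word_value_closed)

lemma npoly_value_mult: "npoly_value n a (p * q) = star n a (npoly_value n a p) (npoly_value n a q)"
proof (induction p rule: poly_mapping_add_induct)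
  case (single v c)
  show ?case
  proof (induction q rule: poly_mapping_add_induct)
    case (single w d)
    have "Poly_Mapping.single v c * Poly_Mapping.single w d = Poly_Mapping.single (v + w) (c * d)"
      by (rule mult_single)
    then show ?case
      by (simp add: npoly_value_def plus_free_word_def word_value_append
          star_cst_mult_left star_cst_mult_right cst_mult mult.assoc)
  qed (simp_all add: npoly_value_def lin_ext_add star_add_right distrib_left)
qed (simp_all add: npoly_value_def lin_ext_add star_add_left distrib_right)

lemma npoly_value_one [simp]: "npoly_value n a 1 = 1"
  by (simp add: npoly_value_def zero_free_word_def flip: single_one)

lemma npoly_value_gen [simp]: "npoly_value n a (gen i) = indet i"
  by (simp add: npoly_value_def gen_def)

lemma npoly_value_cst_mult: "npoly_value n a (cst c * p) = cst c * npoly_value n a p"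
  by (simp add: npoly_value_def lin_ext_cst_mult)

lemma npoly_value_add: "npoly_value n a (p + q) = npoly_value n a p + npoly_value n a q"
  by (simp add: npoly_value_def lin_ext_add)

lemma npoly_value_hom: "ring_hom_ring (free_algebra n) (R_alg n a) (npoly_value n a)"
  by (rule ring_hom_ringI[OF ring_free_algebra ring_R_alg])
     (simp_all add: free_algebra_simps R_alg_simps npoly_value_closed npoly_value_mult npoly_value_add)

text \<open>The lift of \<open>\<Delta>\<^sup>l X\<^sub>i\<close> to the free algebra.\<close>

definition gen_shift :: "nat \<Rightarrow> nat \<Rightarrow> 'k::field_char_0 npoly" where
  "gen_shift i l = (if l \<le> i then gen (i - l) else 0)"

text \<open>The lift of the commutative multiplication by \<open>X\<^sub>i\<close> on the \<open>b\<close>-eigenspace of \<open>\<Gamma>\<close>.\<close>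

definition comm_mult :: "nat \<Rightarrow> 'k::field_char_0 \<Rightarrow> 'k npoly \<Rightarrow> 'k npoly" where
  "comm_mult i b p = (\<Sum>l\<le>i. cst ((- b) gchoose l) * (gen_shift i l * p))"

section \<open>Lifts of commutative monomials to the free algebra\<close>

primrec list_weight :: "'k::field_char_0 \<Rightarrow> nat list \<Rightarrow> 'k" where
  "list_weight a [] = 0"
| "list_weight a (i # w) = a + of_nat i + list_weight a w"

text \<open>A noncommutative preimage of the monomial of the list. The parameter of
  \<open>comm_mult\<close> is the weight of the tail: for letters up to \<open>n\<close> it is the
  \<open>Gamma\<close> eigenvalue of the monomial being multiplied.\<close>

primrec comm_word :: "'k::field_char_0 \<Rightarrow> nat list \<Rightarrow> 'k npoly" where
  "comm_word a [] = 1"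
| "comm_word a (i # w) = comm_mult i (list_weight a w) (comm_word a w)"

primrec list_monom :: "nat list \<Rightarrow> nat \<Rightarrow>\<^sub>0 nat" where
  "list_monom [] = 0"
| "list_monom (i # w) = Poly_Mapping.single i 1 + list_monom w"

lemma Gamma_weight_list_monom:
  "set w \<subseteq> {0..n} \<Longrightarrow> Gamma_weight n a (list_monom w) = list_weight a w"
  by (induction w) (simp_all add: Gamma_weight_add Gamma_weight_single)

lemma gen_shift_0 [simp]: "gen_shift i 0 = gen i"
  by (simp add: gen_shift_def)

lemma gen_shift_eq_0: "i < l \<Longrightarrow> gen_shift i l = 0"
  by (simp add: gen_shift_def)

lemma gen_shift_closed: "i \<le> n \<Longrightarrow> gen_shift i l \<in> carrier (free_algebra n)"
  by (simp add: gen_shift_def gen_closed) (simp add: free_algebra_def)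

lemma comm_mult_eq:
  assumes "i \<le> N"
  shows "comm_mult i b p = (\<Sum>l\<le>N. cst ((- b) gchoose l) * (gen_shift i l * p))"
  unfolding comm_mult_def using assms by (intro sum.mono_neutral_left) (auto simp: gen_shift_eq_0)

lemma comm_mult_closed:
  "i \<le> n \<Longrightarrow> p \<in> carrier (free_algebra n) \<Longrightarrow> comm_mult i b p \<in> carrier (free_algebra n)"
  unfolding comm_mult_def by (intro sum_closed mult_closed const_closed gen_shift_closed)

lemma comm_word_closed: "set w \<subseteq> {0..n} \<Longrightarrow> comm_word a w \<in> carrier (free_algebra n)"
  by (induction w) (auto intro: comm_mult_closed one_closed_free_algebra)

lemma npoly_value_sum: "npoly_value n a (sum f K) = (\<Sum>k\<in>K. npoly_value n a (f k))"
  by (simp add: npoly_value_def lin_ext_sum)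

lemma npoly_value_gen_shift:
  "i \<le> n \<Longrightarrow> npoly_value n a (gen_shift i l) = (Delta n ^^ l) (indet i)"
  by (simp add: gen_shift_def Delta_pow_indet) (simp add: npoly_value_def)

text \<open>\<open>star\<close> with a \<open>b\<close>-eigenvector on the right applies
  \<open>(1 + Delta)^b\<close> to the left factor. That factor is here
  \<open>(1 + Delta)^(-b) X_i\<close>, and the exponents cancel.\<close>

lemma npoly_value_comm_mult:
  assumes "i \<le> n" "Gamma n a (npoly_value n a p) = cst b * npoly_value n a p"
  shows "npoly_value n a (comm_mult i b p) = indet i * npoly_value n a p"
proof -
  have "npoly_value n a (comm_mult i b p) =
      star n a (\<Sum>l\<le>i. cst ((- b) gchoose l) * (Delta n ^^ l) (indet i)) (npoly_value n a p)"
    unfolding comm_mult_def npoly_value_sum npoly_value_cst_mult using assms(1)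
    by (simp add: npoly_value_mult npoly_value_gen_shift star_sum_left star_cst_mult_left)
  also have "(\<Sum>l\<le>i. cst ((- b) gchoose l) * (Delta n ^^ l) (indet i)) = Delta_binom n (- b) (indet i)"
    using assms(1) by (intro Delta_binom_eq[symmetric]) (simp add: Delta_pow_indet)
  finally show ?thesis
    by (simp add: star_eigen[OF assms(2)] Delta_binom_Delta_binom)
qed

lemma npoly_value_comm_word:
  "set w \<subseteq> {0..n} \<Longrightarrow> npoly_value n a (comm_word a w) = Poly_Mapping.single (list_monom w) 1"
proof (induction w)
  case (Cons i w)
  then have IH: "npoly_value n a (comm_word a w) = Poly_Mapping.single (list_monom w) 1"
    by simp
  have "Gamma n a (npoly_value n a (comm_word a w)) = cst (list_weight a w) * npoly_value n a (comm_word a w)"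
    using Cons.prems by (simp add: IH Gamma_single Gamma_weight_list_monom)
  then show ?case
    using Cons.prems by (simp add: npoly_value_comm_mult IH indet_def mult_single)
qed simp

text \<open>The inner letter is multiplied onto 1, of weight 0, where \<open>0 gchoose l\<close>
  leaves only \<open>l = 0\<close>; the outer binomials alone remain.\<close>

lemma comm_word_pair: "comm_word a [i, j] = (\<Sum>l\<le>i. cst ((- (a + of_nat j)) gchoose l) * (gen_shift i l * gen j))"
proof -
  have "comm_mult j 0 1 = (\<Sum>l\<le>0. cst ((- 0 :: 'a) gchoose l) * (gen_shift j l * 1))"
    unfolding comm_mult_def by (intro sum.mono_neutral_right) (auto simp: gbinomial_0_left)
  then show ?thesis
    by (simp add: comm_mult_def)
qed

text \<open>The terms with \<open>l = 0\<close> form the commutator, the others the two sums of the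
  relator. A relation thus says only that the two lifts of \<open>X_i X_j\<close>, one for each
  order of the letters, agree.\<close>

lemma relator_eq: "relator a i j = comm_word a [i, j] - comm_word a [j, i]"
proof -
  have split: "(\<Sum>l\<le>i. cst (b gchoose l) * (gen_shift i l * gen j)) =
      gen i * gen j + (\<Sum>l=1..i. cst (b gchoose l) * (gen (i - l) * gen j))" for b :: 'a and i j
    by (simp add: sum.atMost_shift sum.atLeast1_atMost_eq lessThan_Suc_atMost gen_shift_def)
  show ?thesis
    unfolding comm_word_pair split by (simp add: relator_def)
qed

section \<open>The kernel of the evaluation\<close>

lemma ideal_relation_ideal: "ideal (relation_ideal n a) (free_algebra n)"
  unfolding relation_ideal_def by (rule ring.genideal_ideal[OF ring_free_algebra relators_closed])

lemma relation_ideal_zero: "0 \<in> relation_ideal n a"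
  using additive_subgroup.zero_closed[OF ideal.axioms(1)[OF ideal_relation_ideal]]
  by (simp add: free_algebra_simps)

lemma relation_ideal_add:
  "p \<in> relation_ideal n a \<Longrightarrow> q \<in> relation_ideal n a \<Longrightarrow> p + q \<in> relation_ideal n a"
  using additive_subgroup.a_closed[OF ideal.axioms(1)[OF ideal_relation_ideal]]
  by (simp add: free_algebra_simps)

lemma relation_ideal_mult_left:
  "x \<in> carrier (free_algebra n) \<Longrightarrow> p \<in> relation_ideal n a \<Longrightarrow> x * p \<in> relation_ideal n a"
  using ideal.I_l_closed[OF ideal_relation_ideal] by (simp add: free_algebra_simps)

lemma relation_ideal_mult_right:
  "x \<in> carrier (free_algebra n) \<Longrightarrow> p \<in> relation_ideal n a \<Longrightarrow> p * x \<in> relation_ideal n a"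
  using ideal.I_r_closed[OF ideal_relation_ideal] by (simp add: free_algebra_simps)

lemma relation_ideal_uminus: "p \<in> relation_ideal n a \<Longrightarrow> - p \<in> relation_ideal n a"
  using relation_ideal_mult_left[OF uminus_closed[OF one_closed_free_algebra], of p n a] by simp

definition rel_cong :: "nat \<Rightarrow> 'k::field_char_0 \<Rightarrow> 'k npoly \<Rightarrow> 'k npoly \<Rightarrow> bool" where
  "rel_cong n a p q \<longleftrightarrow> p - q \<in> relation_ideal n a"

lemma rel_cong_refl [simp]: "rel_cong n a p p"
  by (simp add: rel_cong_def relation_ideal_zero)

lemma rel_cong_sym: "rel_cong n a p q \<Longrightarrow> rel_cong n a q p"
  using relation_ideal_uminus[of "p - q" n a] by (simp add: rel_cong_def)

lemma rel_cong_trans [trans]: "rel_cong n a p q \<Longrightarrow> rel_cong n a q r \<Longrightarrow> rel_cong n a p r"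
  using relation_ideal_add[of "p - q" n a "q - r"] by (simp add: rel_cong_def)

lemma rel_cong_add:
  "rel_cong n a p q \<Longrightarrow> rel_cong n a p' q' \<Longrightarrow> rel_cong n a (p + p') (q + q')"
  using relation_ideal_add[of "p - q" n a "p' - q'"] by (simp add: rel_cong_def algebra_simps)

lemma rel_cong_sum:
  "(\<And>k. k \<in> K \<Longrightarrow> rel_cong n a (f k) (g k)) \<Longrightarrow> rel_cong n a (sum f K) (sum g K)"
  by (induction K rule: infinite_finite_induct) (auto intro: rel_cong_add)

lemma rel_cong_mult_left:
  "x \<in> carrier (free_algebra n) \<Longrightarrow> rel_cong n a p q \<Longrightarrow> rel_cong n a (x * p) (x * q)"
  using relation_ideal_mult_left[of x n "p - q" a] by (simp add: rel_cong_def algebra_simps)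

lemma rel_cong_mult_right:
  "x \<in> carrier (free_algebra n) \<Longrightarrow> rel_cong n a p q \<Longrightarrow> rel_cong n a (p * x) (q * x)"
  using relation_ideal_mult_right[of x n "p - q" a] by (simp add: rel_cong_def algebra_simps)

lemma rel_cong_cst_mult: "rel_cong n a p q \<Longrightarrow> rel_cong n a (cst c * p) (cst c * q)"
  by (rule rel_cong_mult_left[OF const_closed])

lemma rel_cong_comm_mult:
  "i \<le> n \<Longrightarrow> rel_cong n a p q \<Longrightarrow> rel_cong n a (comm_mult i b p) (comm_mult i b q)"
  unfolding comm_mult_def
  by (intro rel_cong_sum rel_cong_cst_mult rel_cong_mult_left gen_shift_closed)

lemma rel_cong_comm_word_pair:
  assumes "i \<le> n" "j \<le> n"
  shows "rel_cong n a (comm_word a [i, j]) (comm_word a [j, i])"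
proof -
  have less: "rel_cong n a (comm_word a [i, j]) (comm_word a [j, i])" if "i < j" "j \<le> n" for i j
  proof -
    have "relator a i j \<in> relation_ideal n a"
      using ring.genideal_self[OF ring_free_algebra relators_closed[of n a]] that
      unfolding relation_ideal_def relators_def by blast
    then show ?thesis
      unfolding rel_cong_def relator_eq .
  qed
  \<comment> \<open>Relators come with \<open>i < j\<close>; the opposite order follows by
    symmetry.\<close>
  consider "i < j" | "j < i" | "i = j"
    by linarith
  then show ?thesis
  proof cases
    case 1
    then show ?thesis
      using assms(2) by (rule less)
  next
    case 2
    then show ?thesis
      using assms(1) by (intro rel_cong_sym[OF less])
  next
    case 3
    then show ?thesis
      by (simp only: rel_cong_refl)
  qed
qed

section \<open>Commutation of the lifted multiplications\<close>

definition comm_pair :: "'k::field_char_0 \<Rightarrow> nat \<Rightarrow> nat \<Rightarrow> nat \<Rightarrow> nat \<Rightarrow> 'k npoly" where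
  "comm_pair a i q j k = (if q \<le> i \<and> k \<le> j then comm_word a [i - q, j - k] else 0)"

lemma rel_cong_comm_pair:
  "i \<le> n \<Longrightarrow> j \<le> n \<Longrightarrow> rel_cong n a (comm_pair a i q j k) (comm_pair a j k i q)"
  unfolding comm_pair_def using rel_cong_comm_word_pair[of "i - q" n "j - k" a] by auto

text \<open>The exponent comes from the weight \<open>a + j - k\<close> of \<open>X_(j-k)\<close>.
  Out-of-range shifts are zero, so the sum may run to the common bound \<open>n\<close>, as
  Vandermonde in the form \<open>gbinomial_shift_sum\<close> requires.\<close>

lemma comm_pair_eq:
  assumes "i \<le> n"
  shows "comm_pair a i q j k =
    (\<Sum>l\<le>n. cst ((- (a + of_nat j - of_nat k)) gchoose l) * (gen_shift i (q + l) * gen_shift j k))"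
proof (cases "q \<le> i \<and> k \<le> j")
  case True
  then have "comm_pair a i q j k =
      (\<Sum>l\<le>i - q. cst ((- (a + of_nat j - of_nat k)) gchoose l) * (gen_shift i (q + l) * gen_shift j k))"
    unfolding comm_pair_def comm_word_pair
    by (auto simp: gen_shift_def of_nat_diff add_diff_eq intro!: sum.cong)
  also have "\<dots> = (\<Sum>l\<le>n. cst ((- (a + of_nat j - of_nat k)) gchoose l) * (gen_shift i (q + l) * gen_shift j k))"
    using assms by (intro sum.mono_neutral_left) (auto simp: gen_shift_def split: if_splits)
  finally show ?thesis .
next
  case False
  then show ?thesis
    by (auto simp: comm_pair_def gen_shift_eq_0 intro!: sum.neutral[symmetric])
qed

text \<open>For each \<open>k\<close> the outer exponent splits as
  \<open>-(b + a + j) = (-b - k) + (-(a + j - k))\<close>. Vandermonde, read backwards, uses the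
  second part to rebuild the lift of \<open>X_(i-q) X_(j-k)\<close> and leaves coefficients that
  depend on neither \<open>i\<close> nor \<open>j\<close>.\<close>

lemma comm_mult_comm_mult:
  assumes "i \<le> n" "j \<le> n"
  shows "comm_mult i (b + (a + of_nat j)) (comm_mult j b p) =
    (\<Sum>k\<le>n. \<Sum>q\<le>n. cst (((- b) gchoose k) * ((- b - of_nat k) gchoose q)) * (comm_pair a i q j k * p))"
proof -
  have "comm_mult i (b + (a + of_nat j)) (comm_mult j b p) =
      (\<Sum>l\<le>n. \<Sum>k\<le>n. cst ((- (b + (a + of_nat j))) gchoose l) *
        (cst ((- b) gchoose k) * (gen_shift i l * (gen_shift j k * p))))"
    by (simp only: comm_mult_eq[OF assms(1)] comm_mult_eq[OF assms(2)] sum_distrib_left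
        cst_left_commute[of _ "gen_shift i _", symmetric])
  also have "\<dots> = (\<Sum>k\<le>n. cst ((- b) gchoose k) *
      (\<Sum>l\<le>n. cst ((- (b + (a + of_nat j))) gchoose l) * (gen_shift i l * (gen_shift j k * p))))"
    by (subst sum.swap) (simp only: sum_distrib_left cst_left_commute[of "(- b) gchoose _" "cst _"])
  also have "\<dots> = (\<Sum>k\<le>n. cst ((- b) gchoose k) *
      (\<Sum>q\<le>n. cst ((- b - of_nat k) gchoose q) * (comm_pair a i q j k * p)))"
  proof (rule sum.cong[OF refl], rule arg_cong[of _ _ "(*) _"])
    fix k
    have "(\<Sum>q\<le>n. cst ((- b - of_nat k) gchoose q) * (comm_pair a i q j k * p)) =
        (\<Sum>q\<le>n. cst ((- b - of_nat k) gchoose q) * (\<Sum>l\<le>n. cst ((- (a + of_nat j - of_nat k)) gchoose l) *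
          (gen_shift i (q + l) * (gen_shift j k * p))))"
      by (simp add: comm_pair_eq[OF assms(1)] sum_distrib_right mult.assoc)
    also have "\<dots> = (\<Sum>s\<le>n. cst ((- b - of_nat k + - (a + of_nat j - of_nat k)) gchoose s) *
        (gen_shift i s * (gen_shift j k * p)))"
      using assms(1) by (intro gbinomial_shift_sum) (simp add: gen_shift_eq_0)
    also have "- b - of_nat k + - (a + of_nat j - of_nat k) = - (b + (a + of_nat j))"
      by simp
    finally show "(\<Sum>l\<le>n. cst ((- (b + (a + of_nat j))) gchoose l) * (gen_shift i l * (gen_shift j k * p))) =
        (\<Sum>q\<le>n. cst ((- b - of_nat k) gchoose q) * (comm_pair a i q j k * p))"
      by (rule sym)
  qed
  finally show ?thesis
    by (simp add: sum_distrib_left cst_mult mult.assoc)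
qed

text \<open>The relations reverse each two-letter lift, also in front of \<open>p\<close>, as the
  ideal is two-sided. Since the coefficients are symmetric in \<open>k\<close> and \<open>q\<close>,
  exchanging these indices yields the other composite.\<close>

lemma rel_cong_comm_mult_commute:
  assumes "i \<le> n" "j \<le> n" "p \<in> carrier (free_algebra n)"
  shows "rel_cong n a (comm_mult i (b + (a + of_nat j)) (comm_mult j b p))
    (comm_mult j (b + (a + of_nat i)) (comm_mult i b p))"
proof -
  have "rel_cong n a (comm_mult i (b + (a + of_nat j)) (comm_mult j b p))
      (\<Sum>k\<le>n. \<Sum>q\<le>n. cst (((- b) gchoose k) * ((- b - of_nat k) gchoose q)) * (comm_pair a j k i q * p))"
    unfolding comm_mult_comm_mult[OF assms(1,2)]
    using assms by (intro rel_cong_sum rel_cong_cst_mult rel_cong_mult_right rel_cong_comm_pair)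
  also have "(\<Sum>k\<le>n. \<Sum>q\<le>n. cst (((- b) gchoose k) * ((- b - of_nat k) gchoose q)) * (comm_pair a j k i q * p))
      = comm_mult j (b + (a + of_nat i)) (comm_mult i b p)"
    unfolding comm_mult_comm_mult[OF assms(2,1)]
    by (subst sum.swap) (simp only: gbinomial_mult_shift_commute)
  finally show ?thesis .
qed

section \<open>Sorted words and the linear lift\<close>

lemma list_weight_insort: "list_weight a (insort i w) = a + of_nat i + list_weight a w"
  by (induction w) (simp_all add: algebra_simps)

text \<open>Insertion moves \<open>i\<close> past the smaller letters one at a time; each exchange
  is \<open>rel_cong_comm_mult_commute\<close> with \<open>b\<close> the weight of the remaining
  tail.\<close>

lemma rel_cong_comm_word_insort:
  "i \<le> n \<Longrightarrow> set w \<subseteq> {0..n} \<Longrightarrow> rel_cong n a (comm_word a (insort i w)) (comm_word a (i # w))"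
proof (induction w)
  case (Cons j w)
  show ?case
  proof (cases "i \<le> j")
    case False
    let ?b = "list_weight a w"
    have "rel_cong n a (comm_word a (insort i (j # w))) (comm_mult j (?b + (a + of_nat i)) (comm_word a (i # w)))"
      using Cons False by (auto simp: list_weight_insort add.commute intro: rel_cong_comm_mult)
    also have "rel_cong n a \<dots> (comm_mult i (?b + (a + of_nat j)) (comm_word a (j # w)))"
      using Cons.prems by (auto intro!: rel_cong_comm_mult_commute comm_word_closed)
    finally show ?thesis
      by (simp add: add.commute)
  qed simp
qed simp

definition monom_list :: "(nat \<Rightarrow>\<^sub>0 nat) \<Rightarrow> nat list" where
  "monom_list m = sorted_list_of_multiset (Abs_multiset (Poly_Mapping.lookup m))"

lemma count_Abs_multiset_lookup: "count (Abs_multiset (Poly_Mapping.lookup m)) = Poly_Mapping.lookup m"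
  by (rule count_Abs_multiset) simp

lemma monom_list_zero [simp]: "monom_list 0 = []"
proof -
  have "Abs_multiset (Poly_Mapping.lookup (0 :: nat \<Rightarrow>\<^sub>0 nat)) = {#}"
    by (rule multiset_eqI) (simp add: count_Abs_multiset_lookup)
  then show ?thesis
    by (simp add: monom_list_def)
qed

lemma monom_list_add: "monom_list (Poly_Mapping.single i 1 + m) = insort i (monom_list m)"
proof -
  have "Abs_multiset (Poly_Mapping.lookup (Poly_Mapping.single i 1 + m)) =
      add_mset i (Abs_multiset (Poly_Mapping.lookup m))"
    by (rule multiset_eqI) (simp add: count_Abs_multiset_lookup lookup_add lookup_single when_def)
  then show ?thesis
    by (simp add: monom_list_def)
qed

lemma set_monom_list: "set (monom_list m) = Poly_Mapping.keys m"
proof -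
  have "set (monom_list m) = set_mset (Abs_multiset (Poly_Mapping.lookup m))"
    by (simp add: monom_list_def)
  then show ?thesis
    by (simp add: set_mset_def count_Abs_multiset_lookup in_keys_iff set_eq_iff)
qed

lemma lookup_list_monom: "Poly_Mapping.lookup (list_monom w) i = count (mset w) i"
  by (induction w) (simp_all add: lookup_add lookup_single when_def)

lemma list_monom_monom_list [simp]: "list_monom (monom_list m) = m"
  by (rule poly_mapping_eqI) (simp add: lookup_list_monom monom_list_def count_Abs_multiset_lookup)

text \<open>A linear section of the evaluation, made definite by choosing the sorted list of each
  monomial. Left multiplication by generators is respected modulo the relations.\<close>

definition lift_poly :: "'k::field_char_0 \<Rightarrow> 'k mpoly \<Rightarrow> 'k npoly" where
  "lift_poly a = lin_ext (\<lambda>m. comm_word a (monom_list m))"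

lemma lift_poly_closed: "f \<in> polys_upto n \<Longrightarrow> lift_poly a f \<in> carrier (free_algebra n)"
  unfolding lift_poly_def lin_ext_def polys_upto_def
  by (intro sum_closed mult_closed const_closed comm_word_closed) (simp add: set_monom_list)

lemma npoly_value_lift_poly:
  assumes "f \<in> polys_upto n"
  shows "npoly_value n a (lift_poly a f) = f"
proof -
  have "npoly_value n a (lift_poly a f) =
      (\<Sum>m\<in>Poly_Mapping.keys f. Poly_Mapping.single m (Poly_Mapping.lookup f m))"
    unfolding lift_poly_def lin_ext_def npoly_value_sum using assms
    by (intro sum.cong) (auto simp: npoly_value_cst_mult npoly_value_comm_word polys_upto_def set_monom_list mult_single)
  then show ?thesis
    by (simp add: poly_mapping_sum_singles)
qed

text \<open>\<open>star\<close> by \<open>X_i\<close> expands with exponent \<open>b\<close> into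
  the monomials \<open>X_(i-k) m\<close>. Modulo the relations each is lifted with
  \<open>X_(i-k)\<close> in front, which expands with exponent \<open>-b\<close>; the two series
  cancel.\<close>

lemma rel_cong_lift_poly_star_single:
  assumes "i \<le> n" "Poly_Mapping.keys m \<subseteq> {0..n}"
  shows "rel_cong n a (lift_poly a (star n a (indet i) (Poly_Mapping.single m c)))
    (gen i * lift_poly a (Poly_Mapping.single m c))"
proof -
  let ?b = "Gamma_weight n a m" and ?p = "comm_word a (monom_list m)"
  have b: "list_weight a (monom_list m) = ?b"
    using Gamma_weight_list_monom[of "monom_list m" n a] assms(2) by (simp add: set_monom_list)
  have "star n a (indet i) (Poly_Mapping.single m c) =
      (\<Sum>k\<le>i. cst (?b gchoose k) * (indet (i - k) * Poly_Mapping.single m c))"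
    using assms(1)
    by (simp add: star_single Delta_binom_eq[of i] Delta_pow_indet sum_distrib_right mult.assoc)
  moreover have "indet (i - k) * Poly_Mapping.single m c = Poly_Mapping.single (Poly_Mapping.single (i - k) 1 + m) c" for k
    by (simp add: indet_def mult_single)
  ultimately have "lift_poly a (star n a (indet i) (Poly_Mapping.single m c)) =
      (\<Sum>k\<le>i. cst (?b gchoose k) * (cst c * comm_word a (insort (i - k) (monom_list m))))"
    by (simp only: lift_poly_def lin_ext_sum lin_ext_cst_mult lin_ext_single monom_list_add)
  also have "rel_cong n a \<dots> (\<Sum>k\<le>i. cst (?b gchoose k) * (cst c * comm_word a ((i - k) # monom_list m)))"
    using assms by (intro rel_cong_sum rel_cong_cst_mult rel_cong_comm_word_insort) (auto simp: set_monom_list)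
  also have "\<dots> = cst c * (\<Sum>k\<le>i. cst (?b gchoose k) * (\<Sum>l\<le>i. cst ((- ?b) gchoose l) * (gen_shift i (k + l) * ?p)))"
  proof -
    have "comm_mult (i - k) ?b ?p = (\<Sum>l\<le>i. cst ((- ?b) gchoose l) * (gen_shift i (k + l) * ?p))" if "k \<le> i" for k
      unfolding comm_mult_eq[OF diff_le_self] using that
      by (intro sum.cong) (auto simp: gen_shift_def)
    then show ?thesis
      by (simp add: b sum_distrib_left[of "cst c"] cst_left_commute[of c "cst _"])
  qed
  also have "\<dots> = cst c * (\<Sum>s\<le>i. cst ((?b + - ?b) gchoose s) * (gen_shift i s * ?p))"
    by (subst gbinomial_shift_sum) (simp_all add: gen_shift_eq_0)
  \<comment> \<open>The exponents add up to 0, and \<open>0 gchoose s\<close> vanishes for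
    \<open>s > 0\<close>.\<close>
  also have "(\<Sum>s\<le>i. cst ((?b + - ?b) gchoose s) * (gen_shift i s * ?p)) =
      (\<Sum>s\<le>0. cst ((?b + - ?b) gchoose s) * (gen_shift i s * ?p))"
    by (intro sum.mono_neutral_right) (auto simp: gbinomial_0_left)
  also have "cst c * \<dots> = gen i * lift_poly a (Poly_Mapping.single m c)"
    by (simp add: lift_poly_def cst_left_commute[of c "gen i"])
  finally show ?thesis .
qed

lemma rel_cong_lift_poly_star:
  assumes "i \<le> n" "f \<in> polys_upto n"
  shows "rel_cong n a (lift_poly a (star n a (indet i) f)) (gen i * lift_poly a f)"
proof -
  let ?t = "\<lambda>m. Poly_Mapping.single m (Poly_Mapping.lookup f m)"
  have sum: "lift_poly a (sum g K) = (\<Sum>m\<in>K. lift_poly a (g m))" for g and K :: "(nat \<Rightarrow>\<^sub>0 nat) set"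
    by (simp add: lift_poly_def lin_ext_sum)
  have "rel_cong n a (lift_poly a (star n a (indet i) (\<Sum>m\<in>Poly_Mapping.keys f. ?t m)))
      (gen i * lift_poly a (\<Sum>m\<in>Poly_Mapping.keys f. ?t m))"
    unfolding star_sum_right sum sum_distrib_left using assms
    by (intro rel_cong_sum rel_cong_lift_poly_star_single) (auto simp: polys_upto_def)
  then show ?thesis
    by (simp only: poly_mapping_sum_singles)
qed

lemma rel_cong_lift_poly_word:
  "set w \<subseteq> {0..n} \<Longrightarrow> rel_cong n a (lift_poly a (word_value n a w)) (Poly_Mapping.single (Free_Word w) 1)"
proof (induction w)
  case Nil
  have "lift_poly a 1 = cst 1 * (1 :: 'a npoly)"
    using lin_ext_single[of "\<lambda>m. comm_word a (monom_list m)" 0 1] by (simp add: lift_poly_def)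
  then show ?case
    by (simp flip: zero_free_word_def)
next
  case (Cons i w)
  have "rel_cong n a (lift_poly a (word_value n a (i # w))) (gen i * lift_poly a (word_value n a w))"
    using Cons.prems by (auto intro!: rel_cong_lift_poly_star word_value_closed)
  also have "rel_cong n a \<dots> (gen i * Poly_Mapping.single (Free_Word w) 1)"
    using Cons by (intro rel_cong_mult_left gen_closed) auto
  also have "gen i * Poly_Mapping.single (Free_Word w) 1 = (Poly_Mapping.single (Free_Word (i # w)) 1 :: 'a npoly)"
    by (simp add: gen_def mult_single plus_free_word_def)
  finally show ?case .
qed

text \<open>Hence the value of \<open>p\<close> determines \<open>p\<close> modulo the relations,
  which is the nontrivial inclusion for the kernel.\<close>

lemma rel_cong_lift_poly_npoly_value:
  assumes "p \<in> carrier (free_algebra n)"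
  shows "rel_cong n a (lift_poly a (npoly_value n a p)) p"
proof -
  have "rel_cong n a (\<Sum>w\<in>Poly_Mapping.keys p. cst (Poly_Mapping.lookup p w) * lift_poly a (word_value n a (letters w)))
      (\<Sum>w\<in>Poly_Mapping.keys p. cst (Poly_Mapping.lookup p w) * Poly_Mapping.single (Free_Word (letters w)) 1)"
    using assms by (intro rel_cong_sum rel_cong_cst_mult rel_cong_lift_poly_word) (auto simp: free_algebra_def)
  then show ?thesis
    by (simp add: npoly_value_def lift_poly_def lin_ext_def[of "\<lambda>w. word_value n a (letters w)"]
        lin_ext_sum lin_ext_cst_mult mult_single poly_mapping_sum_singles)
qed

lemma kernel_npoly_value:
  "a_kernel (free_algebra n) (R_alg n a) (npoly_value n a) = relation_ideal n a"
proof
  let ?ker = "a_kernel (free_algebra n) (R_alg n a) (npoly_value n a)"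
  have ker: "?ker = {p \<in> carrier (free_algebra n). npoly_value n a p = 0}"
    by (simp add: a_kernel_def' R_alg_simps)
  have "npoly_value n a (relator a i j) = 0" if "i < j" "j \<le> n" for i j
  proof -
    \<comment> \<open>Both lifts evaluate to the commutative monomial
      \<open>X_i X_j\<close>.\<close>
    have "npoly_value n a (comm_word a [i, j]) = npoly_value n a (comm_word a [j, i])"
      unfolding npoly_value_comm_word[of "[i, j]" n a, simplified] using that
      by (subst (1 2) npoly_value_comm_word) (auto simp: add.commute)
    then show ?thesis
      unfolding relator_eq by (simp add: npoly_value_def lin_ext_diff)
  qed
  then have "relators n a \<subseteq> ?ker"
    using relators_closed[of n a] unfolding ker by (auto simp: relators_def subset_iff)
  then show "relation_ideal n a \<subseteq> ?ker"
    unfolding relation_ideal_def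
    by (intro ring.genideal_minimal[OF ring_free_algebra] ring_hom_ring.kernel_is_ideal[OF npoly_value_hom])
  show "?ker \<subseteq> relation_ideal n a"
  proof
    fix p assume "p \<in> ?ker"
    then have "rel_cong n a (lift_poly a 0) p"
      using rel_cong_lift_poly_npoly_value[of p n a] by (simp add: ker)
    then show "p \<in> relation_ideal n a"
      using relation_ideal_uminus[of "- p" n a] by (simp add: rel_cong_def lift_poly_def)
  qed
qed

section \<open>Counting the relators\<close>

lemma lookup_relator:
  "Poly_Mapping.lookup (relator a i j) (Free_Word [p, q]) =
     (1 when p = i \<and> q = j) - (1 when p = j \<and> q = i) -
     ((\<Sum>k=1..j. ((- (a + of_nat i)) gchoose k) when p = j - k \<and> q = i) -
      (\<Sum>l=1..i. ((- (a + of_nat j)) gchoose l) when p = i - l \<and> q = j))"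
proof -
  have gen2: "gen x * gen y = Poly_Mapping.single (Free_Word [x, y]) (1 :: 'a)" for x y
    by (simp add: gen_def mult_single plus_free_word_def)
  show ?thesis
    by (simp add: relator_def gen2 mult_single lookup_minus lookup_sum lookup_single eq_commute[of p] eq_commute[of q])
qed

text \<open>The relators form a set, so counting them needs distinctness. Among the words
  \<open>[p, q]\<close> with \<open>q < p\<close>, a relator is supported on \<open>q = i\<close>,
  \<open>p \<le> j\<close>, with coefficient -1 at \<open>[j, i]\<close>; so \<open>i\<close> and
  \<open>j\<close> can be read off.\<close>

lemma relator_inject:
  assumes "relator a i j = relator a i' j'" "i < j" "i' < j'"
  shows "i = i' \<and> j = j'"
proof -
  have top: "Poly_Mapping.lookup (relator a i j) (Free_Word [j, i]) = -1" if "i < j" for i j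
    using that by (auto simp: lookup_relator when_def intro!: sum.neutral)
  have bound: "q = i \<and> p \<le> j"
    if "Poly_Mapping.lookup (relator a i j) (Free_Word [p, q]) \<noteq> 0" "i < j" "q < p" for i j p q
  proof (rule ccontr)
    assume "\<not> (q = i \<and> p \<le> j)"
    then have "(\<Sum>k=1..j. ((- (a + of_nat i)) gchoose k) when p = j - k \<and> q = i) = 0"
      by (intro sum.neutral) (auto simp: when_def)
    moreover have "(\<Sum>l=1..i. ((- (a + of_nat j)) gchoose l) when p = i - l \<and> q = j) = 0"
      using that(2,3) by (intro sum.neutral) (auto simp: when_def)
    ultimately have "Poly_Mapping.lookup (relator a i j) (Free_Word [p, q]) = 0"
      using that(2,3) \<open>\<not> (q = i \<and> p \<le> j)\<close> unfolding lookup_relator by (auto simp: when_def)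
    then show False
      using that(1) by simp
  qed
  have "i = i' \<and> j \<le> j'"
    using assms(2,3) by (intro bound) (simp_all add: top flip: assms(1))
  moreover have "i' = i \<and> j' \<le> j"
    using assms(2,3) by (intro bound) (simp_all add: top assms(1))
  ultimately show ?thesis
    by simp
qed

lemma card_relators: "card (relators n a) = Suc n choose 2"
proof -
  have "relators n a = (\<lambda>(j, i). relator a i j) ` (SIGMA j:{..n}. {..<j})"
    unfolding relators_def by (auto simp: image_iff)
  moreover have "inj_on (\<lambda>(j, i). relator a i j) (SIGMA j:{..n}. {..<j})"
    by (auto simp: inj_on_def dest: relator_inject)
  ultimately have "card (relators n a) = (\<Sum>j\<le>n. j)"
    by (simp add: card_image card_SigmaI)
  also have "\<dots> = Suc n choose 2"
    by (induction n) (simp_all add: numeral_2_eq_2)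
  finally show ?thesis .
qed

text \<open>The first isomorphism theorem for the evaluation: \<open>kernel_npoly_value\<close>
  gives the kernel and \<open>lift_poly\<close> the surjectivity. Compatibility with scalars is a
  separate clause because \<open>ring_iso\<close> concerns the ring structure alone.\<close>

theorem proposition3p15:
  fixes n :: nat and a :: "'k::field_char_0"
  assumes "n \<ge> 1"
  shows "card (relators n a) = (n + 1) choose 2 \<and>
    (\<exists>h \<in> ring_iso (free_algebra n Quot relation_ideal n a) (R_alg n a).
       (\<forall>c. \<forall>p \<in> carrier (free_algebra n).
          h (relation_ideal n a +>\<^bsub>free_algebra n\<^esub> (c \<odot>\<^bsub>free_algebra n\<^esub> p))
            = c \<odot>\<^bsub>R_alg n a\<^esub> h (relation_ideal n a +>\<^bsub>free_algebra n\<^esub> p)) \<and>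
       (\<forall>i\<le>n. h (relation_ideal n a +>\<^bsub>free_algebra n\<^esub> gen i) = indet i))"
proof (intro conjI bexI)
  \<comment> \<open>A coset of the kernel has a singleton image, so \<open>the_elem\<close> extracts
    the common value of its members.\<close>
  let ?h = "\<lambda>X. the_elem (npoly_value n a ` X)"
  interpret ring_hom_ring "free_algebra n" "R_alg n a" "npoly_value n a"
    by (rule npoly_value_hom)
  show "card (relators n a) = (n + 1) choose 2"
    by (simp add: card_relators)
  have h: "?h (relation_ideal n a +>\<^bsub>free_algebra n\<^esub> p) = npoly_value n a p"
    if "p \<in> carrier (free_algebra n)" for p
    using the_elem_simp[OF that] by (simp add: kernel_npoly_value)
  have "npoly_value n a ` carrier (free_algebra n) = carrier (R_alg n a)"
  proof
    show "npoly_value n a ` carrier (free_algebra n) \<subseteq> carrier (R_alg n a)"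
      by auto
    show "carrier (R_alg n a) \<subseteq> npoly_value n a ` carrier (free_algebra n)"
      unfolding R_alg_simps by (metis image_eqI lift_poly_closed npoly_value_lift_poly subsetI)
  qed
  then show "?h \<in> ring_iso (free_algebra n Quot relation_ideal n a) (R_alg n a)"
    using FactRing_iso_set by (simp add: kernel_npoly_value)
  show "\<forall>c. \<forall>p \<in> carrier (free_algebra n).
      ?h (relation_ideal n a +>\<^bsub>free_algebra n\<^esub> (c \<odot>\<^bsub>free_algebra n\<^esub> p))
        = c \<odot>\<^bsub>R_alg n a\<^esub> ?h (relation_ideal n a +>\<^bsub>free_algebra n\<^esub> p)"
    by (simp add: free_algebra_simps R_alg_simps h mult_closed const_closed npoly_value_cst_mult)
  show "\<forall>i\<le>n. ?h (relation_ideal n a +>\<^bsub>free_algebra n\<^esub> gen i) = indet i"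
    by (simp add: h gen_closed)
qed

end
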